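(* Let $k_{ap}>0$, $k_{ad}>0$, $\omega_o>0$, $c_r>0$, $d\in\mathbb R$, $L_f\ge0$. Let $f:[0,\infty)\to\mathbb R$ be absolutely continuous with $|\dot f(t)|\le L_f$ for all $t\ge0$. Consider a solution on $[0,\infty)$ of the closed-loop system $$\dot x_1=x_2,\qquad \dot x_2=f(t)-\lambda(t),$$ $$\dot\xi=-\omega_o\xi-\omega_o^2x_2+\omega_o\lambda,\qquad \hat f=\xi+\omega_o x_2,$$ $$\lambda(t)=k_{ap}\big(x_1-r\big)+k_{ad}\big(x_2-\dot r\big)+\hat f(t)-\ddot r(t),$$ where $$r(t)=d+\big(x_1(0)-d\big)e^{-c_rt}+\big(x_2(0)+c_r(x_1(0)-d)\big)te^{-c_rt}.$$ Let $h$ be the impulse response of $H(s)=\frac{1}{s^2+k_{ad}s+k_{ap}}$ and $\|h\|_{L_1}=\int_0^\infty|h(\tau)|\,d\tau$. Then $$\limsup_{T\to\infty}\frac1T\int_0^T\big(x_1(t)-d\big)_+\,dt\le\|h\|_{L_1}\frac{L_f}{\omega_o},$$ where $(z)_+=\max\{z,0\}$.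
   Context: Surrogate model of Lagrangian safe RL: $x_1(t)$ models the population discounted cost return $J_c(\pi(t))$ of the current policy, $x_2$ its derivative, $\lambda$ the Lagrange multiplier, $f$ a lumped unknown disturbance, $(\xi,\hat f)$ a reduced-order extended state observer with gain $\omega_o$, $d$ the cost threshold, and $r$ a critically damped reference (solution of $\ddot r=-2c_r\dot r-c_r^2(r-d)$, $r(0)=x_1(0)$, $\dot r(0)=x_2(0)$) converging to $d$. The impulse response $h$ solves $\ddot h+k_{ad}\dot h+k_{ap}h=0$, $h(0)=0$, $\dot h(0)=1$. *)

theory Defs
  imports "HOL-Analysis.Analysis"
begin

definition abs_continuous_on_interval :: "real \<Rightarrow> real \<Rightarrow> (real \<Rightarrow> real) \<Rightarrow> bool" where
  "abs_continuous_on_interval a b f \<longleftrightarrow>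
     (\<forall>\<epsilon>>0. \<exists>\<delta>>0. \<forall>(n::nat) (l::nat \<Rightarrow> real) (u::nat \<Rightarrow> real).
        (\<forall>i<n. a \<le> l i \<and> l i \<le> u i \<and> u i \<le> b) \<and>
        (\<forall>i<n. \<forall>j<n. i \<noteq> j \<longrightarrow> u i \<le> l j \<or> u j \<le> l i) \<and>
        (\<Sum>i<n. u i - l i) < \<delta>
        \<longrightarrow> (\<Sum>i<n. \<bar>f (u i) - f (l i)\<bar>) < \<epsilon>)"

definition abs_continuous_on_halfline :: "(real \<Rightarrow> real) \<Rightarrow> bool" where
  "abs_continuous_on_halfline f \<longleftrightarrow> (\<forall>T\<ge>0. abs_continuous_on_interval 0 T f)"

definition ref_traj :: "real \<Rightarrow> real \<Rightarrow> real \<Rightarrow> real \<Rightarrow> real \<Rightarrow> real" where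
  "ref_traj c d x10 x20 t =
     d + (x10 - d) * exp (- c * t) + (x20 + c * (x10 - d)) * t * exp (- c * t)"

end

theory Submission
  imports Defs
begin

text \<open>
  An absolutely continuous $f$ whose derivative is bounded by $L_f$ wherever it exists is
  $L_f$-Lipschitz: $f$ is a difference of monotone absolutely continuous functions, whose
  Stieltjes measures have Radon--Nikodym densities, so $f$ is an indefinite integral and by
  Lebesgue differentiation its density is bounded by $L_f$ almost everywhere.

  The observer output $z = \xi + \omega_o x_2$ satisfies $z' = \omega_o (f - z)$, hence the error
  $e = f - z$ is bounded by $L_f / \omega_o$ plus an exponentially decaying term. The tracking error
  $y = x_1 - r$ solves $y'' + k_{ad} y' + k_{ap} y = e$ with zero initial data, so $y = h * e$, and
  since $h$ decays exponentially, $|y| \le \|h\|_{L_1} L_f / \omega_o$ up to an exponentially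
  decaying term. The same holds for $x_1 - d = y + (r - d)$, and averaging removes the transient.
\<close>

subsection \<open>Nonoverlapping families and positive variation\<close>

definition nonoverlapping :: "'i set \<Rightarrow> ('i \<Rightarrow> real) \<Rightarrow> ('i \<Rightarrow> real) \<Rightarrow> bool" where
  "nonoverlapping I l u \<longleftrightarrow> finite I \<and> (\<forall>i\<in>I. l i \<le> u i) \<and>
     (\<forall>i\<in>I. \<forall>j\<in>I. i \<noteq> j \<longrightarrow> u i \<le> l j \<or> u j \<le> l i)"

definition abs_continuous_on_line :: "(real \<Rightarrow> real) \<Rightarrow> bool" where
  "abs_continuous_on_line g \<longleftrightarrow>
     (\<forall>\<epsilon>>0. \<exists>\<delta>>0. \<forall>(n::nat) l u. nonoverlapping {..<n} l u \<and> (\<Sum>i<n. u i - l i) < \<delta>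
        \<longrightarrow> (\<Sum>i<n. \<bar>g (u i) - g (l i)\<bar>) < \<epsilon>)"

lemma nonoverlapping_mono:
  assumes "nonoverlapping I l u" "mono m"
  shows "nonoverlapping I (\<lambda>i. m (l i)) (\<lambda>i. m (u i))"
  using assms unfolding nonoverlapping_def by (meson monoD)

lemma abs_continuous_on_lineD:
  assumes "abs_continuous_on_line g" "\<epsilon> > 0"
  obtains \<delta> where "\<delta> > 0"
    "\<And>(I :: 'i set) l u. nonoverlapping I l u \<Longrightarrow> (\<Sum>i\<in>I. u i - l i) < \<delta> \<Longrightarrow>
       (\<Sum>i\<in>I. \<bar>g (u i) - g (l i)\<bar>) < \<epsilon>"
proof -
  obtain \<delta> where \<delta>: "\<delta> > 0" "\<And>(n::nat) l u. nonoverlapping {..<n} l u \<Longrightarrow> (\<Sum>i<n. u i - l i) < \<delta>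
      \<Longrightarrow> (\<Sum>i<n. \<bar>g (u i) - g (l i)\<bar>) < \<epsilon>"
    using spec[where x=\<epsilon>, THEN mp, OF assms(1)[unfolded abs_continuous_on_line_def] assms(2)]
    by (elim exE conjE) (rule that; blast)
  show thesis
  proof (rule that[OF \<delta>(1)])
    fix I :: "'i set" and l u
    assume I: "nonoverlapping I l u" and less: "(\<Sum>i\<in>I. u i - l i) < \<delta>"
    obtain b where b: "bij_betw b {..<card I} I"
      using I ex_bij_betw_nat_finite[of I] by (auto simp: nonoverlapping_def atLeast0LessThan)
    have "nonoverlapping {..<card I} (\<lambda>i. l (b i)) (\<lambda>i. u (b i))"
      using I bij_betwE[OF b] bij_betw_imp_inj_on[OF b]
      unfolding nonoverlapping_def by (simp add: inj_on_eq_iff)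
    moreover have "(\<Sum>i<card I. u (b i) - l (b i)) < \<delta>"
      using less sum.reindex_bij_betw[OF b, of "\<lambda>i. u i - l i"] by simp
    ultimately have "(\<Sum>i<card I. \<bar>g (u (b i)) - g (l (b i))\<bar>) < \<epsilon>"
      by (rule \<delta>(2))
    then show "(\<Sum>i\<in>I. \<bar>g (u i) - g (l i)\<bar>) < \<epsilon>"
      using sum.reindex_bij_betw[OF b, of "\<lambda>i. \<bar>g (u i) - g (l i)\<bar>"] by simp
  qed
qed

lemma mono_clamp: "mono (\<lambda>x::real. max a (min b x))"
  by (auto simp: mono_def)

lemma clamp_diff_le: "x \<le> y \<Longrightarrow> max a (min b y) - max a (min b x) \<le> y - (x::real)"
  by (simp add: max_def min_def)

lemma abs_continuous_on_line_clamp: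
  assumes "abs_continuous_on_interval a b f" "a \<le> b"
  shows "abs_continuous_on_line (\<lambda>x. f (max a (min b x)))"
  unfolding abs_continuous_on_line_def
proof (intro allI impI)
  fix \<epsilon> :: real assume e: "\<epsilon> > 0"
  obtain \<delta> where \<delta>: "\<delta> > 0" "\<And>(n::nat) l u.
      (\<forall>i<n. a \<le> l i \<and> l i \<le> u i \<and> u i \<le> b) \<and>
        (\<forall>i<n. \<forall>j<n. i \<noteq> j \<longrightarrow> u i \<le> l j \<or> u j \<le> l i) \<and>
        (\<Sum>i<n. u i - l i) < \<delta>
        \<Longrightarrow> (\<Sum>i<n. \<bar>f (u i) - f (l i)\<bar>) < \<epsilon>"
    using spec[where x=\<epsilon>, THEN mp, OF assms(1)[unfolded abs_continuous_on_interval_def] e]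
    by (elim exE conjE) (rule that; blast)
  show "\<exists>\<delta>>0. \<forall>(n::nat) l u. nonoverlapping {..<n} l u \<and> (\<Sum>i<n. u i - l i) < \<delta>
        \<longrightarrow> (\<Sum>i<n. \<bar>f (max a (min b (u i))) - f (max a (min b (l i)))\<bar>) < \<epsilon>"
  proof (intro exI[of _ \<delta>] conjI allI impI \<delta>(1))
    fix n :: nat and l u :: "nat \<Rightarrow> real"
    assume *: "nonoverlapping {..<n} l u \<and> (\<Sum>i<n. u i - l i) < \<delta>"
    let ?c = "\<lambda>x. max a (min b x)"
    have no: "nonoverlapping {..<n} (\<lambda>i. ?c (l i)) (\<lambda>i. ?c (u i))"
      using * mono_clamp by (intro nonoverlapping_mono[where m="?c"]) auto
    have "(\<Sum>i<n. ?c (u i) - ?c (l i)) \<le> (\<Sum>i<n. u i - l i)"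
      using * by (intro sum_mono clamp_diff_le) (simp add: nonoverlapping_def)
    then show "(\<Sum>i<n. \<bar>f (?c (u i)) - f (?c (l i))\<bar>) < \<epsilon>"
      using * no assms(2) by (intro \<delta>(2)) (auto simp: nonoverlapping_def)
  qed
qed

lemma abs_continuous_on_line_continuous:
  assumes "abs_continuous_on_line g"
  shows "continuous_on UNIV g"
proof -
  have "\<exists>\<delta>>0. \<forall>y. dist y x < \<delta> \<longrightarrow> dist (g y) (g x) < \<epsilon>" if e: "\<epsilon> > 0" for x \<epsilon>
  proof -
    obtain \<delta> where \<delta>: "\<delta> > 0"
      "\<And>(I :: unit set) l u. nonoverlapping I l u \<Longrightarrow> (\<Sum>i\<in>I. u i - l i) < \<delta> \<Longrightarrow>
       (\<Sum>i\<in>I. \<bar>g (u i) - g (l i)\<bar>) < \<epsilon>"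
      by (rule abs_continuous_on_lineD[OF assms e]) (rule that; blast)
    have "dist (g y) (g x) < \<epsilon>" if "dist y x < \<delta>" for y
      using \<delta>(2)[of "{()}" "\<lambda>_. min x y" "\<lambda>_. max x y"] that
      by (cases "x \<le> y") (auto simp: nonoverlapping_def dist_real_def max_def min_def)
    then show ?thesis using \<delta>(1) by blast
  qed
  then show ?thesis by (simp add: continuous_on_iff)
qed

lemma abs_continuous_on_line_diff:
  assumes "abs_continuous_on_line f" "abs_continuous_on_line g"
  shows "abs_continuous_on_line (\<lambda>x. f x - g x)"
  unfolding abs_continuous_on_line_def
proof (intro allI impI)
  fix \<epsilon> :: real assume "\<epsilon> > 0"
  then have e: "\<epsilon>/2 > 0" by simp
  obtain \<delta>1 where \<delta>1: "\<delta>1 > 0" "\<And>(I :: nat set) l u. nonoverlapping I l u \<Longrightarrow> (\<Sum>i\<in>I. u i - l i) < \<delta>1 \<Longrightarrow>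
       (\<Sum>i\<in>I. \<bar>f (u i) - f (l i)\<bar>) < \<epsilon>/2"
    by (rule abs_continuous_on_lineD[OF assms(1) e]) (rule that; blast)
  obtain \<delta>2 where \<delta>2: "\<delta>2 > 0" "\<And>(I :: nat set) l u. nonoverlapping I l u \<Longrightarrow> (\<Sum>i\<in>I. u i - l i) < \<delta>2 \<Longrightarrow>
       (\<Sum>i\<in>I. \<bar>g (u i) - g (l i)\<bar>) < \<epsilon>/2"
    by (rule abs_continuous_on_lineD[OF assms(2) e]) (rule that; blast)
  have "(\<Sum>i<n. \<bar>f (u i) - g (u i) - (f (l i) - g (l i))\<bar>) < \<epsilon>"
    if "nonoverlapping {..<n} l u" "(\<Sum>i<n. u i - l i) < min \<delta>1 \<delta>2" for n :: nat and l u
  proof -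
    have "(\<Sum>i<n. \<bar>f (u i) - g (u i) - (f (l i) - g (l i))\<bar>)
        \<le> (\<Sum>i<n. \<bar>f (u i) - f (l i)\<bar> + \<bar>g (u i) - g (l i)\<bar>)"
      by (intro sum_mono) linarith
    also have "\<dots> < \<epsilon>"
      using \<delta>1(2)[of "{..<n}" l u] \<delta>2(2)[of "{..<n}" l u] that by (simp add: sum.distrib)
    finally show ?thesis .
  qed
  then show "\<exists>\<delta>>0. \<forall>(n::nat) l u. nonoverlapping {..<n} l u \<and> (\<Sum>i<n. u i - l i) < \<delta>
        \<longrightarrow> (\<Sum>i<n. \<bar>f (u i) - g (u i) - (f (l i) - g (l i))\<bar>) < \<epsilon>"
    using \<delta>1(1) \<delta>2(1) by (intro exI[of _ "min \<delta>1 \<delta>2"]) auto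
qed

lemma nonoverlapping_sum_length_le:
  assumes "nonoverlapping I l u" "\<And>i. i \<in> I \<Longrightarrow> a \<le> l i \<and> u i \<le> b" "a \<le> b"
  shows "(\<Sum>i\<in>I. u i - l i) \<le> b - a"
proof -
  have fin: "finite I" using assms by (simp add: nonoverlapping_def)
  have "disjoint_family_on (\<lambda>i. {l i<..<u i}) I"
    using assms(1) by (fastforce simp: disjoint_family_on_def nonoverlapping_def)
  then have "measure lborel (\<Union>i\<in>I. {l i<..<u i}) = (\<Sum>i\<in>I. measure lborel {l i<..<u i})"
    using fin assms(1) by (intro measure_finite_Union) (auto simp: nonoverlapping_def)
  also have "\<dots> = (\<Sum>i\<in>I. u i - l i)"
    using assms(1) by (intro sum.cong) (auto simp: nonoverlapping_def)
  finally have "(\<Sum>i\<in>I. u i - l i) = measure lborel (\<Union>i\<in>I. {l i<..<u i})" by simp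
  also have "\<dots> \<le> measure lborel {a..b}"
    using fin assms(2) by (intro measure_mono_fmeasurable) (auto simp: fmeasurable_def emeasure_lborel_Icc_eq dest!: assms(2))
  finally show ?thesis using assms(3) by simp
qed

lemma increment_split:
  fixes g :: "real \<Rightarrow> real"
  assumes "l \<le> u"
  shows "g u - g l = (g (min c u) - g (min c l)) + (g (max c u) - g (max c l))"
  using assms by (auto simp: min_def max_def)

lemma abs_increment_split:
  fixes g :: "real \<Rightarrow> real"
  assumes "l \<le> u"
  shows "\<bar>g u - g l\<bar> \<le> \<bar>g (min c u) - g (min c l)\<bar> + \<bar>g (max c u) - g (max c l)\<bar>"
  using increment_split[OF assms, of g c] by linarith

lemma mono_min: "mono (min (c::real))" and mono_max: "mono (max (c::real))"
  by (auto simp: mono_def)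

definition variation_le :: "(real \<Rightarrow> real) \<Rightarrow> real \<Rightarrow> bool" where
  "variation_le g B \<longleftrightarrow>
     (\<forall>(n::nat) l u. nonoverlapping {..<n} l u \<longrightarrow> (\<Sum>i<n. \<bar>g (u i) - g (l i)\<bar>) \<le> B)"

lemma abs_continuous_clamp_bounded_variation:
  assumes ac: "abs_continuous_on_line g" and "a \<le> b"
    and const: "\<And>x. g (max a (min b x)) = g x"
  obtains B where "variation_le g B"
proof -
  obtain \<delta> where \<delta>: "\<delta> > 0" "\<And>(I :: nat set) l u. nonoverlapping I l u \<Longrightarrow> (\<Sum>i\<in>I. u i - l i) < \<delta> \<Longrightarrow>
       (\<Sum>i\<in>I. \<bar>g (u i) - g (l i)\<bar>) < 1"
    by (rule abs_continuous_on_lineD[OF ac zero_less_one]) (rule that; blast)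
  have *: "(\<Sum>i<n. \<bar>g (u i) - g (l i)\<bar>) \<le> real m"
    if "nonoverlapping {..<n} l u" "\<And>i. i < n \<Longrightarrow> a \<le> l i \<and> u i \<le> a + real m * (\<delta>/2)" for m n :: nat and l u
    using that
  proof (induction m arbitrary: l u)
    case 0
    then have "u i = l i" if "i < n" for i using that by (force simp: nonoverlapping_def)
    then show ?case by simp
  next
    case (Suc m)
    define c where "c = a + real m * (\<delta>/2)"
    have ca: "a \<le> c" using \<delta>(1) by (simp add: c_def)
    have lu: "l i \<le> u i" if "i < n" for i using Suc.prems(1) that by (simp add: nonoverlapping_def)
    have n1: "nonoverlapping {..<n} (\<lambda>i. min c (l i)) (\<lambda>i. min c (u i))"
      and n2: "nonoverlapping {..<n} (\<lambda>i. max c (l i)) (\<lambda>i. max c (u i))"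
      using Suc.prems(1) mono_min mono_max by (auto intro: nonoverlapping_mono)
    have "(\<Sum>i<n. \<bar>g (min c (u i)) - g (min c (l i))\<bar>) \<le> real m"
      using Suc.prems(2) ca by (intro Suc.IH[OF n1]) (auto simp: c_def)
    moreover have "(\<Sum>i<n. max c (u i) - max c (l i)) \<le> (c + \<delta>/2) - c"
      using Suc.prems(2) \<delta>(1)
      by (intro nonoverlapping_sum_length_le[OF n2]) (auto simp: c_def algebra_simps add_divide_distrib)
    then have "(\<Sum>i<n. \<bar>g (max c (u i)) - g (max c (l i))\<bar>) < 1"
      using \<delta>(1) by (intro \<delta>(2)[OF n2]) linarith
    moreover have "(\<Sum>i<n. \<bar>g (u i) - g (l i)\<bar>) \<le>
       (\<Sum>i<n. \<bar>g (min c (u i)) - g (min c (l i))\<bar> + \<bar>g (max c (u i)) - g (max c (l i))\<bar>)"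
      using lu by (intro sum_mono abs_increment_split) auto
    ultimately show ?case by (simp add: sum.distrib)
  qed
  obtain m :: nat where "(b - a) / (\<delta>/2) \<le> real m" using real_arch_simple by blast
  then have m: "b \<le> a + real m * (\<delta>/2)" using \<delta>(1) by (simp add: field_simps)
  show thesis
  proof (rule that[of "real m"], unfold variation_le_def, intro allI impI)
    fix n :: nat and l u :: "nat \<Rightarrow> real"
    assume no: "nonoverlapping {..<n} l u"
    have "nonoverlapping {..<n} (\<lambda>i. max a (min b (l i))) (\<lambda>i. max a (min b (u i)))"
      using nonoverlapping_mono[OF no mono_clamp] .
    from *[OF this, of m] show "(\<Sum>i<n. \<bar>g (u i) - g (l i)\<bar>) \<le> real m"
      using m \<open>a \<le> b\<close> by (auto simp: const)
  qed
qed

definition pos_variation :: "(real \<Rightarrow> real) \<Rightarrow> real \<Rightarrow> real" where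
  "pos_variation g x = Sup {(\<Sum>i<n. g (u i) - g (l i)) |(n::nat) l u.
     nonoverlapping {..<n} l u \<and> (\<forall>i<n. u i \<le> x)}"

context
  fixes g :: "real \<Rightarrow> real" and B :: real
  assumes bv: "variation_le g B"
begin

lemma pos_variation_sums_le:
  assumes "nonoverlapping {..<n::nat} l u"
  shows "(\<Sum>i<n. g (u i) - g (l i)) \<le> B"
proof -
  have "(\<Sum>i<n. g (u i) - g (l i)) \<le> (\<Sum>i<n. \<bar>g (u i) - g (l i)\<bar>)" by (intro sum_mono) simp
  then show ?thesis using bv assms unfolding variation_le_def by force
qed

lemma pos_variation_upper:
  assumes "nonoverlapping {..<n::nat} l u" "\<And>i. i < n \<Longrightarrow> u i \<le> x"
  shows "(\<Sum>i<n. g (u i) - g (l i)) \<le> pos_variation g x"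
  unfolding pos_variation_def
proof (rule cSup_upper)
  show "bdd_above {(\<Sum>i<n. g (u i) - g (l i)) |(n::nat) l u. nonoverlapping {..<n} l u \<and> (\<forall>i<n. u i \<le> x)}"
    by (rule bdd_aboveI[of _ B]) (auto intro: pos_variation_sums_le)
qed (use assms in blast)

lemma pos_variation_approx:
  assumes "\<epsilon> > 0"
  obtains n :: nat and l u where "nonoverlapping {..<n} l u" "\<And>i. i < n \<Longrightarrow> u i \<le> x"
    "pos_variation g x - \<epsilon> < (\<Sum>i<n. g (u i) - g (l i))"
proof -
  let ?S = "{(\<Sum>i<n. g (u i) - g (l i)) |(n::nat) l u. nonoverlapping {..<n} l u \<and> (\<forall>i<n. u i \<le> x)}"
  have "(\<Sum>i<0::nat. g (u i) - g (l i)) \<in> ?S" for l u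
    unfolding mem_Collect_eq by (rule exI[of _ 0]) (auto simp: nonoverlapping_def)
  then have "?S \<noteq> {}" by blast
  from less_cSupD[OF this, of "pos_variation g x - \<epsilon>"] assms
  obtain y where "y \<in> ?S" "pos_variation g x - \<epsilon> < y"
    unfolding pos_variation_def[symmetric] by auto
  then show thesis using that by blast
qed

lemma pos_variation_bounds: "0 \<le> pos_variation g x" "pos_variation g x \<le> B"
proof -
  show "0 \<le> pos_variation g x"
    using pos_variation_upper[of 0] by (simp add: nonoverlapping_def)
  show "pos_variation g x \<le> B"
  proof (rule field_le_epsilon)
    fix e :: real assume e: "e > 0"
    obtain n :: nat and l u where "nonoverlapping {..<n} l u" "\<And>i. i < n \<Longrightarrow> u i \<le> x"
      "pos_variation g x - e < (\<Sum>i<n. g (u i) - g (l i))"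
      by (rule pos_variation_approx[OF e, where x=x]) (rule that, assumption, blast, assumption)
    then show "pos_variation g x \<le> B + e" using pos_variation_sums_le[of n l u] by linarith
  qed
qed

lemma pos_variation_increment_ge:
  assumes "x \<le> y"
  shows "max 0 (g y - g x) \<le> pos_variation g y - pos_variation g x"
proof (rule field_le_epsilon)
  fix e :: real assume e: "e > 0"
  obtain n :: nat and l u where *: "nonoverlapping {..<n} l u" "\<And>i. i < n \<Longrightarrow> u i \<le> x"
    "pos_variation g x - e < (\<Sum>i<n. g (u i) - g (l i))"
    by (rule pos_variation_approx[OF e, where x=x]) (rule that, assumption, blast, assumption)
  have "nonoverlapping {..<Suc n} (l(n := x)) (u(n := y))"
    using *(1,2) assms unfolding nonoverlapping_def by (simp add: lessThan_Suc)
  moreover have "(u(n := y)) i \<le> y" if "i < Suc n" for i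
    using *(2)[of i] assms that by (cases "i = n") auto
  ultimately have "(\<Sum>i<Suc n. g ((u(n:=y)) i) - g ((l(n:=x)) i)) \<le> pos_variation g y"
    by (rule pos_variation_upper)
  moreover have "(\<Sum>i<n. g (u i) - g (l i)) \<le> pos_variation g y"
    using * assms by (intro pos_variation_upper) (auto intro: order_trans)
  ultimately show "max 0 (g y - g x) \<le> pos_variation g y - pos_variation g x + e"
    using *(3) by (auto simp: max_def)
qed

lemma pos_variation_increment_approx:
  assumes "x \<le> y" "\<epsilon> > 0"
  obtains n :: nat and l u where "nonoverlapping {..<n} l u" "\<And>i. i < n \<Longrightarrow> x \<le> l i \<and> u i \<le> y"
    "pos_variation g y - pos_variation g x - \<epsilon> < (\<Sum>i<n. g (u i) - g (l i))"
proof -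
  obtain n :: nat and l u where *: "nonoverlapping {..<n} l u" "\<And>i. i < n \<Longrightarrow> u i \<le> y"
    "pos_variation g y - \<epsilon> < (\<Sum>i<n. g (u i) - g (l i))"
    by (rule pos_variation_approx[OF assms(2), where x=y]) (rule that, assumption, blast, assumption)
  have n1: "nonoverlapping {..<n} (\<lambda>i. min x (l i)) (\<lambda>i. min x (u i))"
    and n2: "nonoverlapping {..<n} (\<lambda>i. max x (l i)) (\<lambda>i. max x (u i))"
    using *(1) mono_min mono_max by (auto intro: nonoverlapping_mono)
  have "(\<Sum>i<n. g (u i) - g (l i)) = (\<Sum>i<n. g (min x (u i)) - g (min x (l i))) + (\<Sum>i<n. g (max x (u i)) - g (max x (l i)))"
    unfolding sum.distrib[symmetric] using *(1)
    by (intro sum.cong increment_split) (auto simp: nonoverlapping_def)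
  moreover have "(\<Sum>i<n. g (min x (u i)) - g (min x (l i))) \<le> pos_variation g x"
    by (rule pos_variation_upper[OF n1]) simp
  ultimately show thesis using that[OF n2] *(2,3) assms(1) by fastforce
qed

lemma abs_continuous_on_line_pos_variation:
  assumes ac: "abs_continuous_on_line g"
  shows "abs_continuous_on_line (pos_variation g)"
  unfolding abs_continuous_on_line_def
proof (intro allI impI)
  fix \<epsilon> :: real assume e: "\<epsilon> > 0"
  then have e3: "\<epsilon>/3 > 0" by simp
  obtain \<delta> where \<delta>: "\<delta> > 0" "\<And>(I :: (nat \<times> nat) set) l u. nonoverlapping I l u \<Longrightarrow> (\<Sum>i\<in>I. u i - l i) < \<delta> \<Longrightarrow>
       (\<Sum>i\<in>I. \<bar>g (u i) - g (l i)\<bar>) < \<epsilon>/3"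
    by (rule abs_continuous_on_lineD[OF ac e3]) (rule that; blast)
  let ?P = "pos_variation g"
  have "(\<Sum>i<n. \<bar>?P (u i) - ?P (l i)\<bar>) < \<epsilon>"
    if no: "nonoverlapping {..<n} l u" and less: "(\<Sum>i<n. u i - l i) < \<delta>" for n :: nat and l u
  proof -
    have lu: "l i \<le> u i" if "i < n" for i using no that by (simp add: nonoverlapping_def)
    define \<eta> where "\<eta> = \<epsilon> / 3 / (real n + 1)"
    have \<eta>: "\<eta> > 0" using e by (simp add: \<eta>_def)
    define R where "R i q \<longleftrightarrow> nonoverlapping {..<fst q::nat} (fst (snd q)) (snd (snd q)) \<and>
       (\<forall>j<fst q. l i \<le> fst (snd q) j \<and> snd (snd q) j \<le> u i) \<and>
       ?P (u i) - ?P (l i) - \<eta> < (\<Sum>j<fst q. g (snd (snd q) j) - g (fst (snd q) j))" for i q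
    have "\<exists>q. R i q" if "i < n" for i
    proof -
      obtain m :: nat and l' u' where "nonoverlapping {..<m} l' u'" "\<And>j. j < m \<Longrightarrow> l i \<le> l' j \<and> u' j \<le> u i"
        "?P (u i) - ?P (l i) - \<eta> < (\<Sum>j<m. g (u' j) - g (l' j))"
        by (rule pos_variation_increment_approx[OF lu[OF \<open>i < n\<close>] \<eta>]) (rule that, assumption, blast, assumption)
      then show ?thesis by (intro exI[of _ "(m, l', u')"]) (simp add: R_def)
    qed
    then obtain q where q: "\<And>i. i < n \<Longrightarrow> R i (q i)" by metis
    define m l' u' where "m = (\<lambda>i. fst (q i))" and "l' = (\<lambda>i. fst (snd (q i)))" and "u' = (\<lambda>i. snd (snd (q i)))"
    have m: "\<And>i. i < n \<Longrightarrow> nonoverlapping {..<m i::nat} (l' i) (u' i)"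
      "\<And>i j. i < n \<Longrightarrow> j < m i \<Longrightarrow> l i \<le> l' i j \<and> u' i j \<le> u i"
      "\<And>i. i < n \<Longrightarrow> ?P (u i) - ?P (l i) - \<eta> < (\<Sum>j<m i. g (u' i j) - g (l' i j))"
      using q by (simp_all add: R_def m_def l'_def u'_def)
    let ?I = "SIGMA i:{..<n}. {..<m i}"
    let ?l = "\<lambda>(i,j). l' i j" and ?u = "\<lambda>(i,j). u' i j"
    have sep: "u' i j \<le> l' k q \<or> u' k q \<le> l' i j" if "i < n" "j < m i" "k < n" "q < m k" "i \<noteq> k" for i j k q
    proof -
      have "u i \<le> l k \<or> u k \<le> l i" using no that by (simp add: nonoverlapping_def)
      then show ?thesis using m(2)[OF that(1,2)] m(2)[OF that(3,4)] by linarith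
    qed
    have sep': "u' i j \<le> l' i q \<or> u' i q \<le> l' i j" if "i < n" "j < m i" "q < m i" "j \<noteq> q" for i j q
      using m(1)[OF that(1)] that by (simp add: nonoverlapping_def)
    have "nonoverlapping ?I ?l ?u"
      unfolding nonoverlapping_def
    proof (intro conjI ballI impI)
      show "finite ?I" by auto
      show "?l p \<le> ?u p" if "p \<in> ?I" for p using that m(1) by (auto simp: nonoverlapping_def)
      show "?u p \<le> ?l q \<or> ?u q \<le> ?l p" if "p \<in> ?I" "q \<in> ?I" "p \<noteq> q" for p q
      proof (cases "fst p = fst q")
        case True
        then show ?thesis using that sep'[of "fst p" "snd p" "snd q"] by (auto simp: split_beta prod_eq_iff)
      next
        case False
        then show ?thesis using that sep[of "fst p" "snd p" "fst q" "snd q"] by (auto simp: split_beta)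
      qed
    qed
    moreover have "(\<Sum>p\<in>?I. ?u p - ?l p) < \<delta>"
    proof -
      have "(\<Sum>p\<in>?I. ?u p - ?l p) = (\<Sum>i<n. \<Sum>j<m i. u' i j - l' i j)"
        by (simp add: sum.Sigma split_beta)
      also have "\<dots> \<le> (\<Sum>i<n. u i - l i)"
        using m(1,2) lu by (intro sum_mono nonoverlapping_sum_length_le) auto
      finally show ?thesis using less by linarith
    qed
    ultimately have "(\<Sum>p\<in>?I. \<bar>g (?u p) - g (?l p)\<bar>) < \<epsilon>/3" by (rule \<delta>(2))
    moreover have "(\<Sum>i<n. \<Sum>j<m i. g (u' i j) - g (l' i j)) \<le> (\<Sum>p\<in>?I. \<bar>g (?u p) - g (?l p)\<bar>)"
      by (subst sum.Sigma) (auto intro!: sum_mono)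
    moreover have "(\<Sum>i<n. \<bar>?P (u i) - ?P (l i)\<bar>) \<le> (\<Sum>i<n. (\<Sum>j<m i. g (u' i j) - g (l' i j)) + \<eta>)"
    proof (intro sum_mono)
      fix i assume "i \<in> {..<n}"
      then have i: "i < n" by simp
      show "\<bar>?P (u i) - ?P (l i)\<bar> \<le> (\<Sum>j<m i. g (u' i j) - g (l' i j)) + \<eta>"
        using m(3)[OF i] pos_variation_increment_ge[OF lu[OF i]] by linarith
    qed
    moreover have "(\<Sum>i<n. \<eta>) \<le> \<epsilon>/3"
      using e by (simp add: \<eta>_def field_simps)
    ultimately show ?thesis using e by (simp add: sum.distrib)
  qed
  then show "\<exists>\<delta>>0. \<forall>(n::nat) l u. nonoverlapping {..<n} l u \<and> (\<Sum>i<n. u i - l i) < \<delta>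
        \<longrightarrow> (\<Sum>i<n. \<bar>?P (u i) - ?P (l i)\<bar>) < \<epsilon>"
    using \<delta>(1) by blast
qed

end

subsection \<open>Absolutely continuous functions are indefinite integrals\<close>

lemma mono_abs_continuous_interval_measure:
  assumes ac: "abs_continuous_on_line F" and "mono F"
  shows "absolutely_continuous lborel (interval_measure F)"
  unfolding absolutely_continuous_def
proof
  fix N :: "real set" assume "N \<in> null_sets lborel"
  then have N: "N \<in> sets borel" "emeasure lborel N = 0" by auto
  note mF = monoD[OF \<open>mono F\<close>]
  have cont: "continuous_on UNIV F" by (rule abs_continuous_on_line_continuous[OF ac])
  let ?\<nu> = "interval_measure F"
  have Icc: "emeasure ?\<nu> {a..b} = ennreal (F b - F a)" if "a \<le> b" for a b
    using that mF cont by (rule emeasure_interval_measure_Icc)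
  have "emeasure ?\<nu> N \<le> ennreal \<epsilon>" if e: "\<epsilon> > 0" for \<epsilon>
  proof -
    obtain \<delta> where \<delta>: "\<delta> > 0" "\<And>(I :: real set set) l u. nonoverlapping I l u \<Longrightarrow> (\<Sum>i\<in>I. u i - l i) < \<delta> \<Longrightarrow>
       (\<Sum>i\<in>I. \<bar>F (u i) - F (l i)\<bar>) < \<epsilon>"
      by (rule abs_continuous_on_lineD[OF ac e]) (rule that; blast)
    obtain U where U: "open U" "N \<subseteq> U" "emeasure lborel (U - N) < ennreal \<delta>"
      using outer_regular_lborel[OF N(1) \<delta>(1)] by blast
    have "emeasure lborel U \<le> emeasure lborel ((U - N) \<union> N)"
      using U N by (intro emeasure_mono) auto
    also have "\<dots> \<le> emeasure lborel (U - N) + emeasure lborel N"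
      using U N by (intro emeasure_subadditive) auto
    finally have "emeasure lborel U \<le> emeasure lborel (U - N) + emeasure lborel N" .
    then have lU: "emeasure lborel U < ennreal \<delta>" using U(3) N by simp
    obtain \<D> where D: "countable \<D>" "\<D> \<subseteq> Pow U" "\<And>X. X \<in> \<D> \<Longrightarrow> \<exists>a b. X = cbox a b" "\<Union>\<D> = U"
      using open_countable_Union_open_cbox[OF U(1)] by metis
    have fin: "emeasure ?\<nu> (\<Union>\<F>) \<le> ennreal \<epsilon>" if F: "finite \<F>" "\<F> \<subseteq> \<D>" for \<F>
    proof -
      obtain p where p: "p division_of (\<Union>\<F>)"
        using elementary_unions_intervals[OF F(1)] D(3) F(2) by (metis subsetD)
      have fp: "finite p" using p by auto
      have KI: "K = {Inf K..Sup K}" and Kle: "Inf K \<le> Sup K" if kp: "K \<in> p" for K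
      proof -
        obtain a b where "K = cbox a b" "K \<noteq> {}" using division_ofD(3,4)[OF p kp] by blast
        then show "K = {Inf K..Sup K}" "Inf K \<le> Sup K" by auto
      qed
      define q where "q = {K\<in>p. Inf K < Sup K}"
      have no: "nonoverlapping q Inf Sup"
        unfolding nonoverlapping_def
      proof (intro conjI ballI impI)
        show "finite q" using fp by (simp add: q_def)
        show "Inf K \<le> Sup K" if "K \<in> q" for K using that by (simp add: q_def)
        fix K L assume KL: "K \<in> q" "L \<in> q" "K \<noteq> L"
        then have "interior K \<inter> interior L = {}" using p by (auto simp: q_def division_of_def)
        moreover have "interior K = {Inf K<..<Sup K}" if "K \<in> q" for K
          using arg_cong[OF KI, of K interior] that by (simp add: q_def)
        from this[OF KL(1)] this[OF KL(2)]
        have "interior K = {Inf K<..<Sup K}" "interior L = {Inf L<..<Sup L}" .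
        ultimately have "{max (Inf K) (Inf L)<..<min (Sup K) (Sup L)} = {}" by auto
        then have "\<not> max (Inf K) (Inf L) < min (Sup K) (Sup L)" by (metis greaterThanLessThan_empty_iff not_le)
        then show "Sup K \<le> Inf L \<or> Sup L \<le> Inf K" using KL by (auto simp: q_def)
      qed
      have "disjoint_family_on (\<lambda>K. {Inf K<..<Sup K}) q"
        using no by (fastforce simp: disjoint_family_on_def nonoverlapping_def)
      then have "(\<Sum>K\<in>q. emeasure lborel {Inf K<..<Sup K}) = emeasure lborel (\<Union>K\<in>q. {Inf K<..<Sup K})"
        using fp by (intro sum_emeasure) (auto simp: q_def)
      also have "\<dots> \<le> emeasure lborel U"
      proof (rule emeasure_mono)
        have "{Inf K<..<Sup K} \<subseteq> U" if "K \<in> q" for K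
        proof -
          have "{Inf K<..<Sup K} \<subseteq> {Inf K..Sup K}" by auto
          also have "\<dots> = K" using KI[of K] that by (simp add: q_def)
          also have "K \<subseteq> \<Union>\<F>" using that division_ofD(2)[OF p] by (simp add: q_def)
          also have "\<Union>\<F> \<subseteq> U" using F D(2) by blast
          finally show ?thesis .
        qed
        then show "(\<Union>K\<in>q. {Inf K<..<Sup K}) \<subseteq> U" by blast
      qed (use U in auto)
      also have "(\<Sum>K\<in>q. emeasure lborel {Inf K<..<Sup K}) = ennreal (\<Sum>K\<in>q. Sup K - Inf K)"
        by (subst sum_ennreal[symmetric]) (auto simp: q_def intro!: sum.cong)
      finally have "ennreal (\<Sum>K\<in>q. Sup K - Inf K) < ennreal \<delta>" using lU by simp
      moreover have "0 \<le> (\<Sum>K\<in>q. Sup K - Inf K)" by (rule sum_nonneg) (simp add: q_def)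
      ultimately have "(\<Sum>K\<in>q. Sup K - Inf K) < \<delta>" by (simp add: ennreal_less_iff)
      then have less: "(\<Sum>K\<in>q. \<bar>F (Sup K) - F (Inf K)\<bar>) < \<epsilon>" by (rule \<delta>(2)[OF no])
      have eq: "emeasure ?\<nu> K = ennreal (F (Sup K) - F (Inf K))" if "K \<in> p" for K
        using Icc[OF Kle[OF that]] KI[OF that] by simp
      have "emeasure ?\<nu> (\<Union>\<F>) = emeasure ?\<nu> (\<Union>K\<in>p. K)" using p by (auto simp: division_of_def)
      also have "\<dots> \<le> (\<Sum>K\<in>p. emeasure ?\<nu> K)"
        using p fp by (intro emeasure_subadditive_finite) (auto dest: division_ofD(4))
      also have "\<dots> = (\<Sum>K\<in>p. ennreal (F (Sup K) - F (Inf K)))" using eq by (intro sum.cong) auto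
      also have "\<dots> = ennreal (\<Sum>K\<in>p. F (Sup K) - F (Inf K))"
        using Kle mF by (intro sum_ennreal) simp
      also have "(\<Sum>K\<in>p. F (Sup K) - F (Inf K)) = (\<Sum>K\<in>q. F (Sup K) - F (Inf K))"
        using Kle fp by (intro sum.mono_neutral_right) (force simp: q_def)+
      also have "\<dots> \<le> (\<Sum>K\<in>q. \<bar>F (Sup K) - F (Inf K)\<bar>)" by (intro sum_mono) simp
      finally show ?thesis using less
        by (meson ennreal_leI less_imp_le order_trans)
    qed
    have "emeasure ?\<nu> U \<le> ennreal \<epsilon>"
    proof (cases "\<D> = {}")
      case True
      then show ?thesis using D by simp
    next
      case False
      define X where "X n = (\<Union>i<n. from_nat_into \<D> i)" for n
      have X: "X n = \<Union>(from_nat_into \<D> ` {..<n})" for n by (simp add: X_def)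
      have ran: "range (from_nat_into \<D>) = \<D>" using D(1) False by (simp add: range_from_nat_into)
      have Xle: "emeasure ?\<nu> (X n) \<le> ennreal \<epsilon>" for n
        unfolding X using ran by (intro fin) auto
      have "(\<Union>n. X n) = \<Union>(range (from_nat_into \<D>))" by (auto simp: X_def)
      then have UX: "U = (\<Union>n. X n)" using D(4) ran by simp
      have SUPX: "(SUP n. emeasure ?\<nu> (X n)) = emeasure ?\<nu> (\<Union>n. X n)"
      proof (rule SUP_emeasure_incseq)
        have "from_nat_into \<D> i \<in> sets borel" for i
          using D(3)[of "from_nat_into \<D> i"] ran rangeI[of "from_nat_into \<D>" i] by auto
        then show "range X \<subseteq> sets ?\<nu>" by (auto simp: X_def)
        show "incseq X" by (force simp: incseq_def X_def)
      qed
      show ?thesis unfolding UX SUPX[symmetric] by (rule SUP_least) (rule Xle)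
    qed
    moreover have "emeasure ?\<nu> N \<le> emeasure ?\<nu> U" using U by (intro emeasure_mono) auto
    ultimately show ?thesis by order
  qed
  then have "emeasure ?\<nu> N = 0"
    by (metis ennreal_le_epsilon add_0 le_zero_eq)
  then show "N \<in> null_sets ?\<nu>" using N by auto
qed

lemma mono_abs_continuous_density:
  assumes ac: "abs_continuous_on_line F" and "mono F" and bounded: "\<And>x. \<bar>F x\<bar> \<le> B"
  obtains \<phi> where "\<And>x y. x \<le> y \<Longrightarrow> (\<phi> has_integral (F y - F x)) {x..y}"
proof -
  let ?\<nu> = "interval_measure F"
  note mF = monoD[OF \<open>mono F\<close>]
  have cont: "continuous_on UNIV F" by (rule abs_continuous_on_line_continuous[OF ac])
  have Icc: "emeasure ?\<nu> {a..b} = ennreal (F b - F a)" if "a \<le> b" for a b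
    using that mF cont by (rule emeasure_interval_measure_Icc)
  have fm: "finite_measure ?\<nu>"
  proof
    have SUPX: "(SUP n. emeasure ?\<nu> {- real n..real n}) = emeasure ?\<nu> (\<Union>n. {- real n..real n})"
      by (rule SUP_emeasure_incseq) (auto simp: incseq_def)
    have UX: "(\<Union>n. {- real n..real n}) = UNIV"
    proof -
      have "\<exists>n. - real n \<le> x \<and> x \<le> real n" for x
        using real_arch_simple[of "\<bar>x\<bar>"] by (auto simp: abs_le_iff) (metis minus_le_iff)
      then show ?thesis by auto
    qed
    have "emeasure ?\<nu> {- real n..real n} \<le> ennreal (2 * B)" for n
      using bounded[of "real n"] bounded[of "- real n"] by (subst Icc) (auto intro!: ennreal_leI)
    then have "emeasure ?\<nu> UNIV \<le> ennreal (2 * B)"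
      unfolding UX[symmetric] SUPX[symmetric] by (rule SUP_least)
    then show "emeasure ?\<nu> (space ?\<nu>) \<noteq> \<infinity>" by (auto simp: top_unique)
  qed
  have abs: "absolutely_continuous lborel ?\<nu>"
    by (rule mono_abs_continuous_interval_measure[OF ac \<open>mono F\<close>])
  obtain \<phi> where \<phi>: "\<phi> \<in> borel_measurable lborel"
    "AE x in lborel. RN_deriv lborel ?\<nu> x = ennreal (\<phi> x)" "\<And>x. 0 \<le> \<phi> x"
    using sigma_finite_measure.real_RN_deriv[OF sigma_finite_lborel fm abs] by auto
  show thesis
  proof (rule that)
    fix x y :: real assume xy: "x \<le> y"
    have "ennreal (F y - F x) = emeasure (density lborel (RN_deriv lborel ?\<nu>)) {x..y}"
      using Icc[OF xy] sigma_finite_measure.density_RN_deriv[OF sigma_finite_lborel abs] by simp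
    also have "\<dots> = (\<integral>\<^sup>+t. RN_deriv lborel ?\<nu> t * indicator {x..y} t \<partial>lborel)"
      by (rule emeasure_density) auto
    also have "\<dots> = (\<integral>\<^sup>+t. ennreal (indicator {x..y} t * \<phi> t) \<partial>lborel)"
      using \<phi>(2) by (intro nn_integral_cong_AE) (auto simp: indicator_def)
    finally have "((\<lambda>t. indicator {x..y} t * \<phi> t) has_integral (F y - F x)) UNIV"
      using \<phi>(1,3) mF[OF xy] by (intro nn_integral_has_integral) (auto simp: indicator_def)
    moreover have "(\<lambda>t. indicator {x..y} t * \<phi> t) = (\<lambda>t. if t \<in> {x..y} then \<phi> t else 0)"
      by (auto simp: indicator_def)
    ultimately show "(\<phi> has_integral (F y - F x)) {x..y}"
      by (simp only: has_integral_restrict_UNIV)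
  qed
qed

lemma abs_continuous_on_interval_density:
  assumes "abs_continuous_on_interval a b f" "a \<le> b"
  obtains \<phi> where "\<And>x y. x \<le> y \<Longrightarrow>
     (\<phi> has_integral (f (max a (min b y)) - f (max a (min b x)))) {x..y}"
proof -
  define g where "g x = f (max a (min b x))" for x
  have ac: "abs_continuous_on_line g"
    unfolding g_def by (rule abs_continuous_on_line_clamp[OF assms])
  have gc: "g (max a (min b x)) = g x" for x using assms(2) by (simp add: g_def)
  obtain B where B: "variation_le g B"
    by (rule abs_continuous_clamp_bounded_variation[OF ac assms(2) gc])
  let ?P = "pos_variation g"
  have acP: "abs_continuous_on_line ?P" by (rule abs_continuous_on_line_pos_variation[OF B ac])
  note inc = pos_variation_increment_ge[OF B] and bnd = pos_variation_bounds[OF B]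
  have mP: "mono ?P" and mN: "mono (\<lambda>x. ?P x - g x)"
    using inc by (fastforce simp: mono_def)+
  have gB: "\<bar>g x\<bar> \<le> \<bar>g 0\<bar> + B" for x
  proof -
    have "(\<Sum>i<1::nat. \<bar>g (max 0 x) - g (min 0 x)\<bar>) \<le> B"
      using B[unfolded variation_le_def, rule_format, of 1 "\<lambda>_. min 0 x" "\<lambda>_. max 0 x"]
      by (auto simp: nonoverlapping_def)
    then show ?thesis by (cases "0 \<le> x") auto
  qed
  have PB: "\<bar>?P x\<bar> \<le> B" for x using bnd[of x] by simp
  obtain p where p: "\<And>x y. x \<le> y \<Longrightarrow> (p has_integral (?P y - ?P x)) {x..y}"
    by (rule mono_abs_continuous_density[OF acP mP PB]) (rule that; blast)
  have NB: "\<bar>?P x - g x\<bar> \<le> B + (\<bar>g 0\<bar> + B)" for x using gB[of x] bnd[of x] by linarith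
  obtain q where q: "\<And>x y. x \<le> y \<Longrightarrow> (q has_integral ((?P y - g y) - (?P x - g x))) {x..y}"
    by (rule mono_abs_continuous_density[OF abs_continuous_on_line_diff[OF acP ac] mN NB]) (rule that; blast)
  show thesis
  proof (rule that)
    fix x y :: real assume "x \<le> y"
    from has_integral_diff[OF p[OF this] q[OF this]]
    show "((\<lambda>t. p t - q t) has_integral (f (max a (min b y)) - f (max a (min b x)))) {x..y}"
      by (simp add: g_def algebra_simps)
  qed
qed

lemma lebesgue_differentiation_right:
  fixes \<phi> :: "real \<Rightarrow> real"
  assumes "\<And>x y. x \<le> y \<Longrightarrow> (\<phi> has_integral (g y - g x)) {x..y}"
  obtains N where "negligible N" "\<And>x. x \<notin> N \<Longrightarrow> (g has_real_derivative \<phi> x) (at_right x)"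
proof -
  have int: "\<phi> integrable_on cbox a b" for a b
    using assms[of a b] by (cases "a \<le> b") (auto simp: integrable_on_def)
  obtain N where N: "negligible N"
    "\<And>x e. \<lbrakk>x \<notin> N; 0 < e\<rbrakk> \<Longrightarrow> \<exists>d>0. \<forall>h. 0 < h \<and> h < d \<longrightarrow>
       norm (integral (cbox x (x + h *\<^sub>R One)) \<phi> /\<^sub>R h ^ DIM(real) - \<phi> x) < e"
    by (rule integrable_ccontinuous_explicit[of \<phi>, OF int]) (erule that, fast)
  show thesis
  proof (rule that[OF N(1)])
    fix x assume x: "x \<notin> N"
    show "(g has_real_derivative \<phi> x) (at_right x)"
      unfolding has_field_derivative_iff tendsto_iff eventually_at
    proof (intro allI impI)
      fix e :: real assume "e > 0"
      then obtain d where d: "d > 0" "\<And>h. 0 < h \<Longrightarrow> h < d \<Longrightarrow> \<bar>integral {x..x+h} \<phi> / h - \<phi> x\<bar> < e"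
        using N(2)[OF x, of e] by (auto simp: divide_inverse mult.commute)
      have "dist ((g y - g x) / (y - x)) (\<phi> x) < e" if "y > x" "dist y x < d" for y
        using d(2)[of "y - x"] that integral_unique[OF assms[of x y]] by (auto simp: dist_real_def)
      then show "\<exists>d>0. \<forall>y\<in>{x<..}. y \<noteq> x \<and> dist y x < d \<longrightarrow> dist ((g y - g x) / (y - x)) (\<phi> x) < e"
        using d(1) by auto
    qed
  qed
qed

lemma lebesgue_differentiation:
  fixes \<phi> :: "real \<Rightarrow> real"
  assumes g: "\<And>x y. x \<le> y \<Longrightarrow> (\<phi> has_integral (g y - g x)) {x..y}"
  obtains N where "negligible N" "\<And>x. x \<notin> N \<Longrightarrow> (g has_real_derivative \<phi> x) (at x)"
proof -
  obtain N1 where N1: "negligible N1" "\<And>x. x \<notin> N1 \<Longrightarrow> (g has_real_derivative \<phi> x) (at_right x)"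
    using lebesgue_differentiation_right[of \<phi> g] g by blast
  have "((\<lambda>x. \<phi> (- x)) has_integral (- g (- y) - - g (- x))) {x..y}" if "x \<le> y" for x y
    using g[of "-y" "-x"] that has_integral_reflect_real[of \<phi> _ "-x" "-y"] by simp
  then obtain N2 where N2: "negligible N2" 
    "\<And>x. x \<notin> N2 \<Longrightarrow> ((\<lambda>x. - g (- x)) has_real_derivative \<phi> (- x)) (at_right x)"
    using lebesgue_differentiation_right[of "\<lambda>x. \<phi> (- x)" "\<lambda>x. - g (- x)"] by blast
  show thesis
  proof (rule that)
    show "negligible (N1 \<union> uminus ` N2)"
      using N1(1) N2(1) by (intro negligible_Un negligible_differentiable_image_negligible differentiable_on_minus differentiable_on_ident) auto
    fix x assume x: "x \<notin> N1 \<union> uminus ` N2"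
    then have "- x \<notin> N2" by force
    from N2(2)[OF this] have "((\<lambda>x. - g (- x)) has_real_derivative \<phi> x) (at (- x) within uminus ` {..<x})"
      by simp
    then have "((\<lambda>x. - g (- x)) \<circ> uminus has_real_derivative \<phi> x * (-1)) (at x within {..<x})"
      by (rule DERIV_image_chain) (auto intro!: derivative_eq_intros)
    then have "((\<lambda>x. - g x) has_real_derivative - \<phi> x) (at x within {..<x})" by (simp add: o_def)
    from DERIV_minus[OF this] have "(g has_real_derivative \<phi> x) (at_left x)" by simp
    moreover have "(g has_real_derivative \<phi> x) (at_right x)" using N1 x by blast
    ultimately show "(g has_real_derivative \<phi> x) (at x)"
      by (simp add: has_field_derivative_iff filterlim_at_split)
  qed
qed

lemma abs_continuous_deriv_bound_imp_lipschitz: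
  assumes ac: "abs_continuous_on_interval a b f"
    and der: "\<And>t D. a < t \<Longrightarrow> t < b \<Longrightarrow> (f has_real_derivative D) (at t) \<Longrightarrow> \<bar>D\<bar> \<le> L"
    and "a \<le> x" "x \<le> y" "y \<le> b" "0 \<le> L"
  shows "\<bar>f y - f x\<bar> \<le> L * (y - x)"
proof -
  have "a \<le> b" using assms by simp
  obtain \<phi> where \<phi>: "\<And>x y. x \<le> y \<Longrightarrow>
     (\<phi> has_integral (f (max a (min b y)) - f (max a (min b x)))) {x..y}"
    by (rule abs_continuous_on_interval_density[OF ac \<open>a \<le> b\<close>]) (rule that; blast)
  obtain N where N: "negligible N" "\<And>x. x \<notin> N \<Longrightarrow> ((\<lambda>x. f (max a (min b x))) has_real_derivative \<phi> x) (at x)"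
    using lebesgue_differentiation[of \<phi> "\<lambda>x. f (max a (min b x))"] \<phi> by blast
  have bound: "\<bar>\<phi> t\<bar> \<le> L" if "t \<notin> N" "a < t" "t < b" for t
  proof (rule der[OF that(2,3)])
    show "(f has_real_derivative \<phi> t) (at t)"
      by (rule has_field_derivative_transform_within_open[OF N(2)[OF that(1)], where S="{a<..<b}"]) (use that in auto)
  qed
  let ?N = "N \<union> {a, b}"
  have "negligible ?N" using N(1) by (metis negligible_Un negligible_finite finite.intros)
  then have "((\<lambda>t. if t \<in> ?N then 0 else \<phi> t) has_integral (f (max a (min b y)) - f (max a (min b x)))) {x..y}"
    by (rule has_integral_spike[OF _ _ \<phi>[OF \<open>x \<le> y\<close>]]) auto
  then have "((\<lambda>t. if t \<in> ?N then 0 else \<phi> t) has_integral (f y - f x)) (cbox x y)"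
    using assms by simp
  from has_integral_bound[OF \<open>0 \<le> L\<close> this] show ?thesis
    using assms bound by (force simp: not_le not_less)
qed

subsection \<open>Linear differential equations of the closed loop\<close>

lemma nonincreasing_from_0:
  fixes g g' :: "real \<Rightarrow> real"
  assumes "0 \<le> T"
    and der: "\<And>t. 0 \<le> t \<Longrightarrow> t \<le> T \<Longrightarrow> (g has_real_derivative g' t) (at t within {0..})"
    and le: "\<And>t. 0 \<le> t \<Longrightarrow> t \<le> T \<Longrightarrow> g' t \<le> 0"
  shows "g T \<le> g 0"
proof (rule DERIV_nonpos_imp_decreasing_open[OF \<open>0 \<le> T\<close>])
  fix t assume t: "0 < t" "t < T"
  have "(g has_real_derivative g' t) (at t within {0<..})"
    by (rule DERIV_subset[OF der]) (use t in auto)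
  then have "(g has_real_derivative g' t) (at t)" using t by (simp add: at_within_open[of t "{0<..}"])
  then show "\<exists>y. (g has_real_derivative y) (at t) \<and> y \<le> 0" using le[of t] t by auto
next
  show "continuous_on {0..T} g"
    by (rule DERIV_continuous_on[where D=g'], rule DERIV_subset[OF der]) auto
qed

text \<open>The Lyapunov function is $V = (h' + k_{ad} h)^2 + h'^2 + 2 k_{ap} h^2$, chosen so that the
  mixed terms of $V'$ cancel.\<close>

lemma damped_oscillator_exp_decay:
  fixes kap kad :: real and h h' :: "real \<Rightarrow> real"
  assumes "kap > 0" "kad > 0"
    and dh: "\<And>t. t \<ge> 0 \<Longrightarrow> (h has_real_derivative h' t) (at t within {0..})"
    and dh': "\<And>t. t \<ge> 0 \<Longrightarrow> (h' has_real_derivative (- kad * h' t - kap * h t)) (at t within {0..})"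
  obtains C a where "C \<ge> 0" "a > 0" "\<And>t. t \<ge> 0 \<Longrightarrow> \<bar>h t\<bar> \<le> C * exp (- (a * t))"
proof -
  define V where "V t = (h' t + kad * h t)\<^sup>2 + (h' t)\<^sup>2 + 2 * kap * (h t)\<^sup>2" for t
  define k where "k = kad * min 1 kap"
  define M where "M = 3 + 2 * kad\<^sup>2 + 2 * kap"
  define a where "a = k / M"
  have M: "M > 0" and k: "k > 0" using assms(1,2) by (auto simp: M_def k_def add_pos_nonneg)
  then have a: "a > 0" by (simp add: a_def)
  have VM: "V t \<le> M * ((h t)\<^sup>2 + (h' t)\<^sup>2)" for t
  proof -
    have "M * ((h t)\<^sup>2 + (h' t)\<^sup>2) - V t =
        (h' t - kad * h t)\<^sup>2 + 3 * (h t)\<^sup>2 + 2 * kad\<^sup>2 * (h' t)\<^sup>2 + 2 * kap * (h' t)\<^sup>2"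
      by (simp add: M_def V_def power2_eq_square algebra_simps)
    also have "\<dots> \<ge> 0" using assms(1) by simp
    finally show ?thesis by simp
  qed
  have kV: "a * V t \<le> kad * (kap * (h t)\<^sup>2 + (h' t)\<^sup>2)" for t
  proof -
    have "a * V t \<le> a * (M * ((h t)\<^sup>2 + (h' t)\<^sup>2))" using a VM by simp
    also have "\<dots> = kad * (min 1 kap * (h t)\<^sup>2 + min 1 kap * (h' t)\<^sup>2)"
      using M by (simp add: a_def k_def algebra_simps)
    also have "\<dots> \<le> kad * (kap * (h t)\<^sup>2 + 1 * (h' t)\<^sup>2)"
      using assms(2) by (intro mult_left_mono add_mono mult_right_mono) auto
    finally show ?thesis by simp
  qed
  define g' where "g' t = 2 * (a * V t - kad * (kap * (h t)\<^sup>2 + (h' t)\<^sup>2)) * exp (2 * a * t)" for t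
  have dg: "((\<lambda>t. V t * exp (2 * a * t)) has_real_derivative g' t) (at t within {0..})" if "t \<ge> 0" for t
    unfolding V_def g'_def
    by (rule derivative_eq_intros dh dh' that refl)+
       (simp add: power2_eq_square algebra_simps)
  have Vdecay: "V t \<le> V 0 * exp (- (2 * a * t))" if "t \<ge> 0" for t
  proof -
    have "2 * (a * V t - kad * (kap * (h t)\<^sup>2 + (h' t)\<^sup>2)) \<le> 0" for t using kV[of t] by simp
    then have "g' t \<le> 0" for t unfolding g'_def by (rule mult_nonpos_nonneg) simp
    then have "V t * exp (2 * a * t) \<le> V 0 * exp (2 * a * 0)"
      by (intro nonincreasing_from_0[OF that dg]) auto
    then show ?thesis by (simp add: exp_minus field_simps)
  qed
  have V0: "V 0 \<ge> 0" using assms(1) by (simp add: V_def)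
  show thesis
  proof (rule that[of "sqrt (V 0 / (2 * kap))" a])
    fix t :: real assume t: "t \<ge> 0"
    have "2 * kap * (h t)\<^sup>2 \<le> V t" by (simp add: V_def)
    with Vdecay[OF t] have "(h t)\<^sup>2 \<le> V 0 / (2 * kap) * exp (- (2 * a * t))"
      using assms(1) by (simp add: field_simps)
    also have "\<dots> = (sqrt (V 0 / (2 * kap)) * exp (- (a * t)))\<^sup>2"
      using V0 assms(1) by (simp add: power_mult_distrib exp_double[symmetric] mult.assoc)
    finally have "\<bar>h t\<bar>\<^sup>2 \<le> (sqrt (V 0 / (2 * kap)) * exp (- (a * t)))\<^sup>2" by simp
    then show "\<bar>h t\<bar> \<le> sqrt (V 0 / (2 * kap)) * exp (- (a * t))"
      by (rule power2_le_imp_le) (use V0 assms(1) in simp)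
  qed (use a V0 assms(1) in auto)
qed

text \<open>For fixed $T$ the affine function $q(s) = f(T) + L(T - s) + L/\omega$ solves
  $q' = \omega (f(T) + L(T - s) - q)$, so the Lipschitz bound makes $(z - q) e^{\omega s}$
  nonincreasing. No derivative of $f$ is needed.\<close>

lemma first_order_observer_upper:
  fixes f z :: "real \<Rightarrow> real"
  assumes "w > 0" "T \<ge> 0"
    and lip: "\<And>s t. 0 \<le> s \<Longrightarrow> s \<le> t \<Longrightarrow> \<bar>f t - f s\<bar> \<le> L * (t - s)"
    and dz: "\<And>t. t \<ge> 0 \<Longrightarrow> (z has_real_derivative w * (f t - z t)) (at t within {0..})"
  shows "z T - f T \<le> L / w + \<bar>f 0 - z 0\<bar> * exp (- (w * T))"
proof -
  define q where "q s = f T + L * (T - s) + L / w" for s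
  have L: "L \<ge> 0" using lip[of 0 1] by simp
  have "(z T - q T) * exp (w * T) \<le> (z 0 - q 0) * exp (w * 0)"
  proof (rule nonincreasing_from_0[OF \<open>T \<ge> 0\<close>, where g' = "\<lambda>s. w * (f s - f T - L * (T - s)) * exp (w * s)"])
    fix s :: real assume s: "0 \<le> s" "s \<le> T"
    show "((\<lambda>s. (z s - q s) * exp (w * s)) has_real_derivative
        w * (f s - f T - L * (T - s)) * exp (w * s)) (at s within {0..})"
      unfolding q_def
      by (rule derivative_eq_intros dz s refl)+ (use \<open>w > 0\<close> in \<open>simp add: field_simps\<close>)
    have "f s - f T - L * (T - s) \<le> 0" using lip[OF s] by linarith
    then show "w * (f s - f T - L * (T - s)) * exp (w * s) \<le> 0"
      using \<open>w > 0\<close> by (intro mult_nonpos_nonneg mult_nonneg_nonpos) auto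
  qed
  also have "\<dots> \<le> \<bar>f 0 - z 0\<bar>"
    using lip[of 0 T] L \<open>T \<ge> 0\<close> \<open>w > 0\<close> by (simp add: q_def) (smt (verit) divide_nonneg_pos)
  finally show ?thesis by (simp add: q_def exp_minus field_simps)
qed

lemma first_order_observer_error:
  fixes f z :: "real \<Rightarrow> real"
  assumes "w > 0" "T \<ge> 0"
    and lip: "\<And>s t. 0 \<le> s \<Longrightarrow> s \<le> t \<Longrightarrow> \<bar>f t - f s\<bar> \<le> L * (t - s)"
    and dz: "\<And>t. t \<ge> 0 \<Longrightarrow> (z has_real_derivative w * (f t - z t)) (at t within {0..})"
  shows "\<bar>f T - z T\<bar> \<le> L / w + \<bar>f 0 - z 0\<bar> * exp (- (w * T))"
proof -
  have "z T - f T \<le> L / w + \<bar>f 0 - z 0\<bar> * exp (- (w * T))"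
    using lip dz by (rule first_order_observer_upper[OF assms(1,2)])
  moreover have "- z T - - f T \<le> L / w + \<bar>- f 0 - - z 0\<bar> * exp (- (w * T))"
  proof (rule first_order_observer_upper[OF assms(1,2)])
    show "\<bar>- f t - - f s\<bar> \<le> L * (t - s)" if "0 \<le> s" "s \<le> t" for s t
      using lip[OF that] by linarith
    show "((\<lambda>t. - z t) has_real_derivative w * (- f t - - z t)) (at t within {0..})" if "t \<ge> 0" for t
      using DERIV_minus[OF dz[OF that]] by (simp add: algebra_simps)
  qed
  moreover have "\<bar>- f 0 - - z 0\<bar> = \<bar>f 0 - z 0\<bar>" by linarith
  ultimately show ?thesis by (simp add: abs_le_iff)
qed

lemma second_order_duhamel:
  fixes kap kad :: real and h h' y y' e :: "real \<Rightarrow> real"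
  assumes dh: "\<And>t. t \<ge> 0 \<Longrightarrow> (h has_real_derivative h' t) (at t within {0..})"
    and dh': "\<And>t. t \<ge> 0 \<Longrightarrow> (h' has_real_derivative (- kad * h' t - kap * h t)) (at t within {0..})"
    and h0: "h 0 = 0" "h' 0 = 1"
    and dy: "\<And>t. t \<ge> 0 \<Longrightarrow> (y has_real_derivative y' t) (at t within {0..})"
    and dy': "\<And>t. t \<ge> 0 \<Longrightarrow> (y' has_real_derivative (e t - kad * y' t - kap * y t)) (at t within {0..})"
    and y0: "y 0 = 0" "y' 0 = 0"
    and t: "t \<ge> 0"
  shows "((\<lambda>s. h (t - s) * e s) has_integral y t) {0..t}"
proof -
  define G where "G s = h (t - s) * y' s + (h' (t - s) + kad * h (t - s)) * y s" for s
  have "((\<lambda>s. h (t - s) * e s) has_integral (G t - G 0)) {0..t}"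
  proof (rule fundamental_theorem_of_calculus[OF t])
    fix s assume s: "s \<in> {0..t}"
    have im: "(\<lambda>s. t - s) ` {0..t} \<subseteq> {0..}" by auto
    have d: "((\<lambda>s. t - s) has_real_derivative - 1) (at s within {0..t})"
      by (auto intro!: derivative_eq_intros)
    have 1: "((\<lambda>s. h (t - s)) has_real_derivative - h' (t - s)) (at s within {0..t})"
      using DERIV_image_chain[OF DERIV_subset[OF dh[of "t - s"] im] d] s by (simp add: o_def)
    have 2: "((\<lambda>s. h' (t - s)) has_real_derivative kad * h' (t - s) + kap * h (t - s)) (at s within {0..t})"
      using DERIV_image_chain[OF DERIV_subset[OF dh'[of "t - s"] im] d] s by (simp add: o_def add.commute)
    have 3: "(y has_real_derivative y' s) (at s within {0..t})"
      by (rule DERIV_subset[OF dy]) (use s in auto)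
    have 4: "(y' has_real_derivative e s - kad * y' s - kap * y s) (at s within {0..t})"
      by (rule DERIV_subset[OF dy']) (use s in auto)
    have "(G has_real_derivative h (t - s) * e s) (at s within {0..t})"
      unfolding G_def by (rule derivative_eq_intros 1 2 3 4 refl)+ (simp add: algebra_simps)
    then show "(G has_vector_derivative h (t - s) * e s) (at s within {0..t})"
      by (simp add: has_real_derivative_iff_has_vector_derivative)
  qed
  then show ?thesis by (simp add: G_def h0 y0)
qed

lemma abs_integrable_on_halfline_exp_bound:
  fixes h :: "real \<Rightarrow> real"
  assumes cont: "continuous_on {0..} h" and "a > 0"
    and bound: "\<And>t. t \<ge> 0 \<Longrightarrow> \<bar>h t\<bar> \<le> C * exp (- (a * t))"
  shows "(\<lambda>t. \<bar>h t\<bar>) integrable_on {0..}"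
proof (rule measurable_bounded_by_integrable_imp_integrable)
  show "(\<lambda>t. \<bar>h t\<bar>) \<in> borel_measurable (lebesgue_on {0..})"
    using cont by (intro continuous_imp_measurable_on_sets_lebesgue continuous_intros) auto
  show "(\<lambda>t. C * exp (- (a * t))) integrable_on {0..}"
    using integrable_on_cmult_left[OF integrable_on_exp_minus_to_infinity[OF \<open>a > 0\<close>], of C] by simp
qed (use bound in auto)

lemma exp_decay_convolution_bound:
  fixes h e :: "real \<Rightarrow> real"
  assumes cont: "continuous_on {0..} h" and "a > 0" "w > 0" "C \<ge> 0" "t \<ge> 0"
    and hb: "\<And>t. t \<ge> 0 \<Longrightarrow> \<bar>h t\<bar> \<le> C * exp (- (a * t))"
    and eb: "\<And>t. t \<ge> 0 \<Longrightarrow> \<bar>e t\<bar> \<le> K + E * exp (- (w * t))"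
    and "K \<ge> 0" "E \<ge> 0"
    and int: "((\<lambda>s. h (t - s) * e s) has_integral Y) {0..t}"
  shows "\<bar>Y\<bar> \<le> integral {0..} (\<lambda>t. \<bar>h t\<bar>) * K + C * E * (t * exp (- (min a w * t)))"
proof -
  define b where "b = min a w"
  have ch: "continuous_on {0..t} (\<lambda>s. \<bar>h (t - s)\<bar>)"
    by (intro continuous_intros continuous_on_compose2[OF cont]) auto
  have ih: "(\<lambda>s. \<bar>h (t - s)\<bar>) integrable_on {0..t}"
    by (rule integrable_continuous_real[OF ch])
  have "integral {0..t} (\<lambda>s. \<bar>h (t - s)\<bar>) = integral {-t..-0} (\<lambda>s. \<bar>h (t + s)\<bar>)"
    using has_integral_reflect_real[of "\<lambda>s. \<bar>h (t - s)\<bar>" _ t 0] integrable_integral[OF ih]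
    by (intro integral_unique[symmetric]) simp
  also have "\<dots> = integral {-t + t..-0 + t} (\<lambda>s. \<bar>h s\<bar>)"
  proof -
    have "continuous_on {-t + t..-0 + t} (\<lambda>s. \<bar>h s\<bar>)"
      by (intro continuous_intros continuous_on_subset[OF cont]) auto
    from integral_shift[OF this] show ?thesis by (simp add: o_def add.commute)
  qed
  also have "\<dots> \<le> integral {0..} (\<lambda>t. \<bar>h t\<bar>)"
  proof (rule integral_subset_le)
    show "(\<lambda>s. \<bar>h s\<bar>) integrable_on {-t + t..-0 + t}"
      by (intro integrable_continuous_real continuous_intros continuous_on_subset[OF cont]) auto
    show "(\<lambda>t. \<bar>h t\<bar>) integrable_on {0..}"
      by (rule abs_integrable_on_halfline_exp_bound[OF cont \<open>a > 0\<close> hb])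
  qed auto
  finally have H: "integral {0..t} (\<lambda>s. \<bar>h (t - s)\<bar>) \<le> integral {0..} (\<lambda>t. \<bar>h t\<bar>)" .
  have bnd: "((\<lambda>s. \<bar>h (t - s)\<bar> * K + C * E * exp (- (b * t))) has_integral
      (integral {0..t} (\<lambda>s. \<bar>h (t - s)\<bar>) * K + C * E * exp (- (b * t)) * t)) {0..t}"
    using has_integral_const_real[of "C * E * exp (- (b * t))" 0 t] \<open>t \<ge> 0\<close>
    by (intro has_integral_add has_integral_mult_left integrable_integral ih) (simp add: mult.commute)
  have pw: "\<bar>h (t - s) * e s\<bar> \<le> \<bar>h (t - s)\<bar> * K + C * E * exp (- (b * t))" if s: "s \<in> {0..t}" for s
  proof -
    have "\<bar>h (t - s) * e s\<bar> \<le> \<bar>h (t - s)\<bar> * (K + E * exp (- (w * s)))"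
      using eb[of s] s by (simp add: abs_mult mult_left_mono)
    also have "\<dots> = \<bar>h (t - s)\<bar> * K + \<bar>h (t - s)\<bar> * (E * exp (- (w * s)))" by (simp add: algebra_simps)
    also have "\<bar>h (t - s)\<bar> * (E * exp (- (w * s))) \<le> (C * exp (- (a * (t - s)))) * (E * exp (- (w * s)))"
      using hb[of "t - s"] s \<open>E \<ge> 0\<close> by (intro mult_right_mono) auto
    also have "\<dots> = C * E * exp (- (a * (t - s)) + - (w * s))" by (simp only: exp_add mult_ac)
    also have "\<dots> \<le> C * E * exp (- (b * t))"
    proof -
      have "b * (t - s) \<le> a * (t - s)" "b * s \<le> w * s"
        using s by (auto simp: b_def intro!: mult_right_mono)
      then have "- (a * (t - s)) + - (w * s) \<le> - (b * t)" by (simp add: algebra_simps)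
      then show ?thesis using \<open>C \<ge> 0\<close> \<open>E \<ge> 0\<close> by (intro mult_left_mono) auto
    qed
    finally show ?thesis by simp
  qed
  have "norm (integral {0..t} (\<lambda>s. h (t - s) * e s)) \<le> integral {0..t} (\<lambda>s. \<bar>h (t - s)\<bar> * K + C * E * exp (- (b * t)))"
    using int bnd pw by (intro integral_norm_bound_integral) (auto simp: integrable_on_def)
  also have "\<dots> = integral {0..t} (\<lambda>s. \<bar>h (t - s)\<bar>) * K + C * E * exp (- (b * t)) * t"
    by (rule integral_unique[OF bnd])
  also have "\<dots> \<le> integral {0..} (\<lambda>t. \<bar>h t\<bar>) * K + C * E * exp (- (b * t)) * t"
    using H \<open>K \<ge> 0\<close> by (intro add_right_mono mult_right_mono)
  finally show ?thesis using integral_unique[OF int] by (simp add: b_def mult_ac)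
qed

lemma mult_exp_minus_le:
  fixes b t :: real
  assumes "b > 0"
  shows "t * exp (- (b * t)) \<le> 2 / b * exp (- (b / 2 * t))"
proof -
  have "b / 2 * t \<le> exp (b / 2 * t)" using exp_ge_add_one_self[of "b / 2 * t"] by linarith
  then have "t \<le> 2 / b * exp (b / 2 * t)" using assms by (simp add: field_simps)
  then have "t * exp (- (b * t)) \<le> 2 / b * exp (b / 2 * t) * exp (- (b * t))"
    by (intro mult_right_mono) auto
  also have "\<dots> = 2 / b * exp (- (b / 2 * t))"
    by (simp add: mult.assoc exp_add[symmetric])
  finally show ?thesis .
qed

lemma limsup_average_le:
  fixes u :: "real \<Rightarrow> real"
  assumes cont: "continuous_on {0..} u" and "\<beta> > 0" "G \<ge> 0"
    and le: "\<And>t. t \<ge> 0 \<Longrightarrow> u t \<le> K + G * exp (- (\<beta> * t))"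
  shows "Limsup at_top (\<lambda>T. ereal ((1 / T) * integral {0..T} u)) \<le> ereal K"
proof -
  have avg: "(1 / T) * integral {0..T} u \<le> K + G / \<beta> / T" if T: "T > 0" for T
  proof -
    have "((\<lambda>t. K + G * exp (- (\<beta> * t))) has_integral
        ((K * T - G / \<beta> * exp (- (\<beta> * T))) - (K * 0 - G / \<beta> * exp (- (\<beta> * 0))))) {0..T}"
    proof (rule fundamental_theorem_of_calculus)
      show "((\<lambda>t. K * t - G / \<beta> * exp (- (\<beta> * t))) has_vector_derivative K + G * exp (- (\<beta> * t))) (at t within {0..T})" for t
        unfolding has_real_derivative_iff_has_vector_derivative[symmetric]
        using \<open>\<beta> > 0\<close> by (auto intro!: derivative_eq_intros)
    qed (use T in simp)
    then have "integral {0..T} u \<le> (K * T - G / \<beta> * exp (- (\<beta> * T))) - (K * 0 - G / \<beta> * exp (- (\<beta> * 0)))"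
      by (rule has_integral_le[OF integrable_integral, rotated])
         (use le in \<open>auto intro!: integrable_continuous_real continuous_on_subset[OF cont]\<close>)
    also have "\<dots> \<le> K * T + G / \<beta>" using \<open>\<beta> > 0\<close> \<open>G \<ge> 0\<close> by simp
    finally have "(1 / T) * integral {0..T} u \<le> (1 / T) * (K * T + G / \<beta>)"
      using T by (intro mult_left_mono) auto
    also have "\<dots> = K + G / \<beta> / T" using T by (simp add: field_simps)
    finally show ?thesis .
  qed
  have "((\<lambda>T. K + G / \<beta> / T) \<longlongrightarrow> K + 0) at_top"
    by (intro tendsto_add tendsto_const tendsto_divide_0[OF tendsto_const] filterlim_at_top_imp_at_infinity filterlim_ident)
  then have "((\<lambda>T. ereal (K + G / \<beta> / T)) \<longlongrightarrow> ereal K) at_top" by simp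
  then have "Limsup at_top (\<lambda>T. ereal (K + G / \<beta> / T)) = ereal K"
    by (intro lim_imp_Limsup) auto
  moreover have "Limsup at_top (\<lambda>T. ereal ((1 / T) * integral {0..T} u)) \<le> Limsup at_top (\<lambda>T. ereal (K + G / \<beta> / T))"
    using avg by (intro Limsup_mono) (auto intro: eventually_mono[OF eventually_gt_at_top[of 0]])
  ultimately show ?thesis by simp
qed

lemma ref_traj_derivs:
  fixes c d p q :: real
  defines "B \<equiv> q + c * (p - d)"
  shows "(ref_traj c d p q has_real_derivative deriv (ref_traj c d p q) t) (at t)"
    and "(deriv (ref_traj c d p q) has_real_derivative deriv (deriv (ref_traj c d p q)) t) (at t)"
    and "deriv (ref_traj c d p q) 0 = q"
proof -
  define r' where "r' t = (q - c * B * t) * exp (- c * t)" for t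
  have 1: "(ref_traj c d p q has_real_derivative r' t) (at t)" for t
    unfolding ref_traj_def r'_def B_def
    by (auto intro!: derivative_eq_intros simp: algebra_simps)
  then have eq: "deriv (ref_traj c d p q) = r'" by (auto intro: DERIV_imp_deriv)
  have "(r' has_real_derivative (- c * B - c * (q - c * B * t)) * exp (- c * t)) (at t)" for t
    unfolding r'_def by (auto intro!: derivative_eq_intros simp: algebra_simps)
  then show "(deriv (ref_traj c d p q) has_real_derivative deriv (deriv (ref_traj c d p q)) t) (at t)"
    unfolding eq by (metis DERIV_imp_deriv)
  show "(ref_traj c d p q has_real_derivative deriv (ref_traj c d p q) t) (at t)" using 1 by (simp add: eq)
  show "deriv (ref_traj c d p q) 0 = q" by (simp add: eq r'_def)
qed

lemma ref_traj_exp_decay: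
  assumes "c > 0" "t \<ge> 0"
  shows "ref_traj c d p q t - d \<le> (\<bar>p - d\<bar> + \<bar>q + c * (p - d)\<bar> * (2 / c)) * exp (- (c / 2 * t))"
proof -
  have "c * t \<ge> 0" using assms by simp
  have "ref_traj c d p q t - d = (p - d) * exp (- (c * t)) + (q + c * (p - d)) * (t * exp (- (c * t)))"
    by (simp add: ref_traj_def)
  also have "\<dots> \<le> \<bar>p - d\<bar> * exp (- (c / 2 * t)) + \<bar>q + c * (p - d)\<bar> * (2 / c * exp (- (c / 2 * t)))"
    using assms \<open>c * t \<ge> 0\<close> by (intro add_mono mult_mono mult_exp_minus_le) auto
  finally show ?thesis by (simp add: algebra_simps)
qed

theorem theoremC8:
  fixes kap kad wo cr d Lf :: real
    and f x1 x2 xi lam h h' :: "real \<Rightarrow> real"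
  assumes kap: "kap > 0" and kad: "kad > 0" and wo: "wo > 0" and cr: "cr > 0"
    and Lf: "Lf \<ge> 0"
    and f_ac: "abs_continuous_on_halfline f"
    and f_der: "\<And>t D. t \<ge> 0 \<Longrightarrow> (f has_real_derivative D) (at t within {0..}) \<Longrightarrow> \<bar>D\<bar> \<le> Lf"
    and dx1: "\<And>t. t \<ge> 0 \<Longrightarrow> (x1 has_real_derivative x2 t) (at t within {0..})"
    and dx2: "\<And>t. t \<ge> 0 \<Longrightarrow> (x2 has_real_derivative (f t - lam t)) (at t within {0..})"
    and dxi: "\<And>t. t \<ge> 0 \<Longrightarrow>
               (xi has_real_derivative (- wo * xi t - wo\<^sup>2 * x2 t + wo * lam t)) (at t within {0..})"
    and lam: "\<And>t. t \<ge> 0 \<Longrightarrow>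
               lam t = kap * (x1 t - ref_traj cr d (x1 0) (x2 0) t)
                     + kad * (x2 t - deriv (ref_traj cr d (x1 0) (x2 0)) t)
                     + (xi t + wo * x2 t)
                     - deriv (deriv (ref_traj cr d (x1 0) (x2 0))) t"
    and dh: "\<And>t. t \<ge> 0 \<Longrightarrow> (h has_real_derivative h' t) (at t within {0..})"
    and dh': "\<And>t. t \<ge> 0 \<Longrightarrow> (h' has_real_derivative (- kad * h' t - kap * h t)) (at t within {0..})"
    and h0: "h 0 = 0" and h'0: "h' 0 = 1"
  shows "Limsup at_top (\<lambda>T. ereal ((1 / T) * integral {0..T} (\<lambda>t. max (x1 t - d) 0)))
           \<le> ereal (integral {0..} (\<lambda>t. \<bar>h t\<bar>) * (Lf / wo))"
proof -
  let ?r = "ref_traj cr d (x1 0) (x2 0)"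
  let ?H = "integral {0..} (\<lambda>t. \<bar>h t\<bar>)"
  have lip: "\<bar>f t - f s\<bar> \<le> Lf * (t - s)" if "0 \<le> s" "s \<le> t" for s t
  proof (rule abs_continuous_deriv_bound_imp_lipschitz[OF _ _ that order_refl Lf])
    show "abs_continuous_on_interval 0 t f"
      using f_ac that by (simp add: abs_continuous_on_halfline_def)
    show "\<bar>D\<bar> \<le> Lf" if "0 < \<tau>" "(f has_real_derivative D) (at \<tau>)" for \<tau> D
      using f_der[of \<tau> D] that by (simp add: has_field_derivative_at_within)
  qed
  define z where "z t = xi t + wo * x2 t" for t
  have dz: "(z has_real_derivative wo * (f t - z t)) (at t within {0..})" if "t \<ge> 0" for t
    unfolding z_def
    by (rule derivative_eq_intros dxi dx2 that refl)+ (simp add: algebra_simps power2_eq_square)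
  define e where "e t = f t - z t" for t
  define E where "E = \<bar>f 0 - z 0\<bar>"
  have eb: "\<bar>e t\<bar> \<le> Lf / wo + E * exp (- (wo * t))" if "t \<ge> 0" for t
    unfolding e_def E_def using lip dz by (rule first_order_observer_error[OF wo that])
  define y where "y t = x1 t - ?r t" for t
  define y' where "y' t = x2 t - deriv ?r t" for t
  have dy: "(y has_real_derivative y' t) (at t within {0..})" if "t \<ge> 0" for t
    unfolding y_def y'_def
    by (intro DERIV_diff dx1 that has_field_derivative_at_within[OF ref_traj_derivs(1)])
  have dy': "(y' has_real_derivative e t - kad * y' t - kap * y t) (at t within {0..})" if "t \<ge> 0" for t
  proof -
    have "(y' has_real_derivative (f t - lam t) - deriv (deriv ?r) t) (at t within {0..})"
      unfolding y'_def
      by (intro DERIV_diff dx2 that has_field_derivative_at_within[OF ref_traj_derivs(2)])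
    also have "(f t - lam t) - deriv (deriv ?r) t = e t - kad * y' t - kap * y t"
      by (simp add: lam[OF that] e_def z_def y_def y'_def)
    finally show ?thesis .
  qed
  have y0: "y 0 = 0" "y' 0 = 0"
    by (simp_all add: y_def y'_def ref_traj_derivs(3)) (simp add: ref_traj_def)
  obtain C a where C: "C \<ge> 0" "a > 0" "\<And>t. t \<ge> 0 \<Longrightarrow> \<bar>h t\<bar> \<le> C * exp (- (a * t))"
    using damped_oscillator_exp_decay[OF kap kad dh dh'] by blast
  define b where "b = min a wo"
  have b: "b > 0" using C wo by (simp add: b_def)
  have ch: "continuous_on {0..} h" by (rule DERIV_continuous_on[OF dh]) auto
  have yb: "y t \<le> ?H * (Lf / wo) + C * E * (t * exp (- (b * t)))" if "t \<ge> 0" for t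
  proof -
    have "\<bar>y t\<bar> \<le> ?H * (Lf / wo) + C * E * (t * exp (- (min a wo * t)))"
      by (rule exp_decay_convolution_bound[OF ch C(2) wo C(1) that C(3) eb])
         (use Lf wo second_order_duhamel[OF dh dh' h0 h'0 dy dy' y0 that] in \<open>auto simp: E_def\<close>)
    then show ?thesis by (simp add: b_def)
  qed
  define R where "R = \<bar>x1 0 - d\<bar> + \<bar>x2 0 + cr * (x1 0 - d)\<bar> * (2 / cr)"
  define \<beta> where "\<beta> = min (b / 2) (cr / 2)"
  have \<beta>: "\<beta> > 0" using b cr by (simp add: \<beta>_def)
  have E0: "E \<ge> 0" and R0: "R \<ge> 0" using cr by (simp_all add: E_def R_def)
  have H0: "?H \<ge> 0"
    by (rule integral_nonneg[OF abs_integrable_on_halfline_exp_bound[OF ch C(2,3)]]) auto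
  have bound: "max (x1 t - d) 0 \<le> ?H * (Lf / wo) + (C * E * (2 / b) + R) * exp (- (\<beta> * t))" if t: "t \<ge> 0" for t
  proof -
    have "\<beta> * t \<le> b / 2 * t" "\<beta> * t \<le> cr / 2 * t" 
      using t by (intro mult_right_mono; simp add: \<beta>_def)+
    then have ex: "exp (- (b / 2 * t)) \<le> exp (- (\<beta> * t))" "exp (- (cr / 2 * t)) \<le> exp (- (\<beta> * t))" by auto
    have "y t \<le> ?H * (Lf / wo) + C * E * (2 / b * exp (- (\<beta> * t)))"
    proof -
      have "t * exp (- (b * t)) \<le> 2 / b * exp (- (\<beta> * t))"
        using mult_exp_minus_le[OF b, of t] mult_left_mono[OF ex(1), of "2 / b"] b by simp
      then have "C * E * (t * exp (- (b * t))) \<le> C * E * (2 / b * exp (- (\<beta> * t)))"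
        using C(1) E0 by (intro mult_left_mono) auto
      then show ?thesis using yb[OF t] by linarith
    qed
    moreover have "?r t - d \<le> R * exp (- (\<beta> * t))"
      using ref_traj_exp_decay[OF cr t, of d "x1 0" "x2 0"] mult_left_mono[OF ex(2) R0]
      unfolding R_def by linarith
    moreover have "0 \<le> ?H * (Lf / wo) + (C * E * (2 / b) + R) * exp (- (\<beta> * t))"
      using H0 Lf wo C(1) E0 b R0 by simp
    ultimately show ?thesis by (simp add: y_def algebra_simps)
  qed
  show ?thesis
  proof (rule limsup_average_le[OF _ \<beta> _ bound])
    show "continuous_on {0..} (\<lambda>t. max (x1 t - d) 0)"
      by (intro continuous_intros DERIV_continuous_on[OF dx1]) auto
    show "0 \<le> C * E * (2 / b) + R" using C(1) E0 b R0 by simp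
  qed
qed

end
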